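(* Let $G=(X,\Sigma,\delta,X_0)$ be a non-deterministic finite-state automaton with $\Sigma=\Sigma_o\,\dot\cup\,\Sigma_{uo}$, and let $\Gamma\subseteq\Sigma_o$ be a set of anonymous events with $|\Gamma|\ge 2$. Let $P_{str}$ and $P_w$ be the strong and weak anonymous projections, and let $\widehat X$ be the state set of the augmented automaton of $G$. (i) For all integers $\widehat K>K\ge|X|\cdot 2^{|X|}$, $G$ is $K$-step strongly anonymous w.r.t. $\Sigma_o$, $\Gamma$ and $P_{str}$ if and only if $G$ is $\widehat K$-step strongly anonymous w.r.t. $\Sigma_o$, $\Gamma$ and $P_{str}$. (ii) For all integers $\widehat K>K\ge|\widehat X|\cdot 2^{|\widehat X|}$, $G$ is $K$-step weakly anonymous w.r.t. $\Sigma_o$, $\Gamma$ and $P_w$ if and only if $G$ is $\widehat K$-step weakly anonymous w.r.t. $\Sigma_o$, $\Gamma$ and $P_w$.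
   Context: $\epsilon$ is the empty string. A non-deterministic finite-state automaton is $G=(X,\Sigma,\delta,X_0)$ with finite state set $X$, finite event set $\Sigma$, transition function $\delta:X\times\Sigma\to 2^X$ (extended to $X\times\Sigma^*$ in the usual way, with $\delta(x,\epsilon)=\{x\}$), and initial states $X_0\subseteq X$. $\mathcal{L}(G,x)=\{s\in\Sigma^*\mid\delta(x,s)\ne\emptyset\}$ and $\mathcal{L}(G)=\bigcup_{x_0\in X_0}\mathcal{L}(G,x_0)$. $\Sigma_o$ and $\Sigma_{uo}$ are the observable and unobservable events. Strong anonymous projection: fix a symbol $\gamma\notin\Sigma$. $P_{str}:\Sigma^*\to(\Sigma_o\cup\{\gamma\})^*$ is given by $P_{str}(\epsilon)=\epsilon$ and $P_{str}(s\sigma)=P_{str}(s)\gamma$ if $\sigma\in\Gamma$; $=P_{str}(s)\sigma$ if $\sigma\in\Sigma_o\setminus\Gamma$; $=P_{str}(s)$ if $\sigma\in\Sigma_{uo}$. Weak anonymous projection: let $\Gamma_w=\{\gamma_1,\dots,\gamma_{|\Gamma|}\}$ be a set of distinct labels, disjoint from $\Sigma_o$. For a string $\mu$, $E_\Gamma(\mu)$ is the set of events of $\Gamma$ appearing in $\mu$. For $\sigma\in\Gamma$ and a string $s=\mu\sigma v$ with $\mu\in(\Sigma\setminus\{\sigma\})^*$ and $v\in\Sigma^*$, put $R(s,\sigma)=|E_\Gamma(\mu)|+1$. $P_w:\Sigma^*\to(\Sigma_o\cup\Gamma_w)^*$ is given by $P_w(\epsilon)=\epsilon$ and $P_w(s\sigma)=P_w(s)\gamma_{R(s\sigma,\sigma)}$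 if $\sigma\in\Gamma$; $=P_w(s)\sigma$ if $\sigma\in\Sigma_o\setminus\Gamma$; $=P_w(s)$ if $\sigma\in\Sigma_{uo}$. Delayed state estimate, for $\Pi\in\{P_{str},P_w\}$ and $\alpha\beta\in\Pi(\mathcal{L}(G))$: $$\widehat{E}_G(\Pi,\alpha|\alpha\beta)=\{x\in X\mid\exists x_0\in X_0,\exists s\in\mathcal{L}(G,x_0),\exists t\in\mathcal{L}(G,x):\Pi(s)=\alpha\wedge x\in\delta(x_0,s)\wedge\Pi(st)=\alpha\beta\}.$$ $G$ is $K$-step strongly (resp. weakly) anonymous w.r.t. $\Sigma_o,\Gamma$ and $\Pi=P_{str}$ (resp. $\Pi=P_w$) if for all $st\in\mathcal{L}(G)$ with $\Pi(s)=\alpha$, $\Pi(st)=\alpha\beta$ and $|\beta|\le K$, one has $|\widehat{E}_G(\Pi,\alpha|\alpha\beta)|>1$. State set of the augmented automaton: $\widehat X$ is the set of pairs $(x,p)$ with $x\in X$ and $p=\{(\sigma^1)_1,\dots,(\sigma^i)_i\}$ a set of indexed events, where $0\le i\le|\Gamma|$ and $\sigma^1,\dots,\sigma^i\in\Gamma$ are distinct ($p$ is written $\epsilon$ when $i=0$). Thus $|\widehat X|=|X|\sum_{k=0}^{|\Gamma|}\frac{|\Gamma|!}{k!}$. *)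

theory Defs
  imports Main
begin

section \<open>Non-deterministic finite-state automata\<close>

record ('x, 'e) automaton =
  states :: "'x set"
  events :: "'e set"
  trans :: "'x \<Rightarrow> 'e \<Rightarrow> 'x set"
  initials :: "'x set"

definition nfa :: "('x, 'e) automaton \<Rightarrow> bool" where
  "nfa G \<longleftrightarrow> finite (states G) \<and> finite (events G) \<and> initials G \<subseteq> states G \<and>
     (\<forall>x\<in>states G. \<forall>\<sigma>\<in>events G. trans G x \<sigma> \<subseteq> states G)"

fun trans_ext :: "('x, 'e) automaton \<Rightarrow> 'x \<Rightarrow> 'e list \<Rightarrow> 'x set" where
  "trans_ext G x [] = {x}"
| "trans_ext G x (\<sigma> # s) = (\<Union>y\<in>trans G x \<sigma>. trans_ext G y s)"

definition lang_from :: "('x, 'e) automaton \<Rightarrow> 'x \<Rightarrow> 'e list set" where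
  "lang_from G x = {s \<in> lists (events G). trans_ext G x s \<noteq> {}}"

definition lang :: "('x, 'e) automaton \<Rightarrow> 'e list set" where
  "lang G = (\<Union>x0\<in>initials G. lang_from G x0)"


section \<open>Anonymous projections\<close>

text \<open>
  Projected symbols live in a sum type: \<open>Inl\<close> tags an observable event that is kept, \<open>Inr\<close>
  tags a fresh label. The label \<open>\<gamma>\<close> is \<open>Inr ()\<close> and \<open>\<gamma>\<^sub>i\<close> is \<open>Inr i\<close>, so labels are distinct from
  each other and from all events by construction. Both projections are only relevant on strings
  over the automaton's events; there, the last case of each definition is the unobservable one.
\<close>

function P_str :: "'e set \<Rightarrow> 'e set \<Rightarrow> 'e list \<Rightarrow> ('e + unit) list" where
  "P_str \<Sigma>\<^sub>o \<Gamma> [] = []"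
| "P_str \<Sigma>\<^sub>o \<Gamma> (s @ [\<sigma>]) =
     (if \<sigma> \<in> \<Gamma> then P_str \<Sigma>\<^sub>o \<Gamma> s @ [Inr ()]
      else if \<sigma> \<in> \<Sigma>\<^sub>o then P_str \<Sigma>\<^sub>o \<Gamma> s @ [Inl \<sigma>]
      else P_str \<Sigma>\<^sub>o \<Gamma> s)"
  by (metis prod_cases3 rev_exhaust) auto
termination by (relation "measure (\<lambda>(_, _, s). length s)") auto

definition anon_events :: "'e set \<Rightarrow> 'e list \<Rightarrow> 'e set" where
  "anon_events \<Gamma> \<mu> = \<Gamma> \<inter> set \<mu>"

text \<open>
  If \<open>s = \<mu> @ \<sigma> # v\<close> with \<open>\<sigma> \<notin> set \<mu>\<close>, then the \<open>takeWhile\<close> prefix below is \<open>\<mu>\<close>;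
  the value is irrelevant if \<open>\<sigma>\<close> does not occur in \<open>s\<close>.
\<close>

definition rank :: "'e set \<Rightarrow> 'e list \<Rightarrow> 'e \<Rightarrow> nat" where
  "rank \<Gamma> s \<sigma> = card (anon_events \<Gamma> (takeWhile (\<lambda>\<tau>. \<tau> \<noteq> \<sigma>) s)) + 1"

function P_w :: "'e set \<Rightarrow> 'e set \<Rightarrow> 'e list \<Rightarrow> ('e + nat) list" where
  "P_w \<Sigma>\<^sub>o \<Gamma> [] = []"
| "P_w \<Sigma>\<^sub>o \<Gamma> (s @ [\<sigma>]) =
     (if \<sigma> \<in> \<Gamma> then P_w \<Sigma>\<^sub>o \<Gamma> s @ [Inr (rank \<Gamma> (s @ [\<sigma>]) \<sigma>)]
      else if \<sigma> \<in> \<Sigma>\<^sub>o then P_w \<Sigma>\<^sub>o \<Gamma> s @ [Inl \<sigma>]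
      else P_w \<Sigma>\<^sub>o \<Gamma> s)"
  by (metis prod_cases3 rev_exhaust) auto
termination by (relation "measure (\<lambda>(_, _, s). length s)") auto


section \<open>Delayed state estimates and anonymity\<close>

text \<open>In \<open>delayed_estimate G \<Pi> \<alpha> \<omega>\<close>, the argument \<open>\<omega>\<close> is the whole observation \<open>\<alpha> @ \<beta>\<close>.\<close>

definition delayed_estimate ::
  "('x, 'e) automaton \<Rightarrow> ('e list \<Rightarrow> 'o list) \<Rightarrow> 'o list \<Rightarrow> 'o list \<Rightarrow> 'x set" where
  "delayed_estimate G \<Pi> \<alpha> \<omega> =
     {x \<in> states G. \<exists>x0\<in>initials G. \<exists>s\<in>lang_from G x0. \<exists>t\<in>lang_from G x.
        \<Pi> s = \<alpha> \<and> x \<in> trans_ext G x0 s \<and> \<Pi> (s @ t) = \<omega>}"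

definition step_anonymous ::
  "nat \<Rightarrow> ('x, 'e) automaton \<Rightarrow> ('e list \<Rightarrow> 'o list) \<Rightarrow> bool" where
  "step_anonymous K G \<Pi> \<longleftrightarrow>
     (\<forall>s t \<alpha> \<beta>. s @ t \<in> lang G \<and> \<Pi> s = \<alpha> \<and> \<Pi> (s @ t) = \<alpha> @ \<beta> \<and> length \<beta> \<le> K \<longrightarrow>
        card (delayed_estimate G \<Pi> \<alpha> (\<alpha> @ \<beta>)) > 1)"

definition strongly_anonymous ::
  "nat \<Rightarrow> ('x, 'e) automaton \<Rightarrow> 'e set \<Rightarrow> 'e set \<Rightarrow> bool" where
  "strongly_anonymous K G \<Sigma>\<^sub>o \<Gamma> \<longleftrightarrow> step_anonymous K G (P_str \<Sigma>\<^sub>o \<Gamma>)"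

definition weakly_anonymous ::
  "nat \<Rightarrow> ('x, 'e) automaton \<Rightarrow> 'e set \<Rightarrow> 'e set \<Rightarrow> bool" where
  "weakly_anonymous K G \<Sigma>\<^sub>o \<Gamma> \<longleftrightarrow> step_anonymous K G (P_w \<Sigma>\<^sub>o \<Gamma>)"


section \<open>State set of the augmented automaton\<close>

text \<open>The indexed event \<open>(\<sigma>)\<^sub>j\<close> is the pair \<open>(\<sigma>, j)\<close>, with indices starting at 1.\<close>

definition indexed_events :: "'e list \<Rightarrow> ('e \<times> nat) set" where
  "indexed_events ws = {(ws ! j, j + 1) | j. j < length ws}"

definition augmented_states ::
  "('x, 'e) automaton \<Rightarrow> 'e set \<Rightarrow> ('x \<times> ('e \<times> nat) set) set" where
  "augmented_states G \<Gamma> =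
     states G \<times> {indexed_events ws | ws. distinct ws \<and> set ws \<subseteq> \<Gamma>}"

end

(*
  Both projections are computed by a transducer with finite memory: no memory for P_str, and for
  P_w the list of anonymous events in order of first appearance. Pairing states with memories gives
  an automaton with state set Q in which a violation of anonymity is a reachable observation alpha,
  a state x and an observation beta possible after alpha from some pair with first component x, but
  from none of the pairs B with another first component. For each prefix of beta, record a pair
  that it leads to and from which the rest of beta is possible, together with the set of pairs that
  it reaches from B. There are only card Q * 2 ^ card Q such records, so a longer beta has a
  repetition, and cutting it out leaves a shorter violation for the same alpha and x.
*)
theory Submission
  imports Defs
begin

section \<open>Pumping down\<close>

text \<open>\<open>D\<close> is kept abstract so that silent moves may hide in it. The bound is
  strict because a word of length \<open>n\<close> has \<open>n + 1\<close> prefixes.\<close>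

lemma shorten_separating_word:
  fixes D :: "'q \<Rightarrow> 'o list \<Rightarrow> 'q set"
  assumes split: "\<And>q u v. D q (u @ v) = (\<Union>p\<in>D q u. D p v)"
    and closed: "\<And>q u. q \<in> Q \<Longrightarrow> D q u \<subseteq> Q"
    and fin: "finite Q" and q: "q \<in> Q" and B: "B \<subseteq> Q"
    and "D q w \<noteq> {}" and "\<forall>b\<in>B. D b w = {}"
  shows "\<exists>v. length v < card Q * 2 ^ card Q \<and> D q v \<noteq> {} \<and> (\<forall>b\<in>B. D b v = {})"
  using assms(6,7)
proof (induction w rule: length_induct)
  case (1 w)
  show ?case
  proof (cases "length w < card Q * 2 ^ card Q")
    case True
    with 1 show ?thesis by blast
  next
    case False
    \<comment> \<open>The states \<open>r i\<close> are chosen separately for each cut and need not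
      lie on one run: splicing only needs each to be reached by the prefix and to admit the
      rest.\<close>
    have "\<exists>p. p \<in> D q (take i w) \<and> D p (drop i w) \<noteq> {}" for i
      using "1.prems"(1) split[of q "take i w" "drop i w"] by auto
    then obtain r where r: "\<And>i. r i \<in> D q (take i w)" "\<And>i. D (r i) (drop i w) \<noteq> {}"
      by metis
    define S where "S i = (\<Union>b\<in>B. D b (take i w))" for i
    have S: "S i \<in> Pow Q" for i
      using B closed unfolding S_def by blast
    have "\<not> inj_on (\<lambda>i. (r i, S i)) {..length w}"
    proof
      assume inj: "inj_on (\<lambda>i. (r i, S i)) {..length w}"
      have "(\<lambda>i. (r i, S i)) ` {..length w} \<subseteq> Q \<times> Pow Q"
        using r(1) closed[OF q] S by blast
      then have "card {..length w} \<le> card (Q \<times> Pow Q)"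
        using fin by (intro card_inj_on_le[OF inj]) auto
      with False fin show False
        by (simp add: card_cartesian_product card_Pow)
    qed
    then obtain i j where ij: "i < j" "j \<le> length w" "r i = r j" "S i = S j"
      unfolding inj_on_def by (metis atMost_iff nat_neq_iff prod.inject)
    \<comment> \<open>The prefix leads \<open>q\<close> to \<open>r i = r j\<close>, from where
      \<open>drop j w\<close> is possible.\<close>
    let ?v = "take i w @ drop j w"
    have "length ?v < length w"
      using ij by simp
    moreover have "D q ?v \<noteq> {}"
      using r(1)[of i] r(2)[of j] ij(3) split[of q "take i w" "drop j w"] by auto
    moreover have "D b ?v = {}" if b: "b \<in> B" for b
    proof -
      \<comment> \<open>As \<open>S i = S j\<close>, such a \<open>p\<close> is also reached from
        some \<open>b'\<close> in \<open>B\<close> by \<open>take j w\<close>; continuing with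
        \<open>drop j w\<close> would make all of \<open>w\<close> possible from
        \<open>b'\<close>.\<close>
      have "D p (drop j w) = {}" if "p \<in> D b (take i w)" for p
      proof -
        have "p \<in> S j" using that b ij(4) unfolding S_def by blast
        then obtain b' where "b' \<in> B" "p \<in> D b' (take j w)"
          unfolding S_def by blast
        with "1.prems"(2) split[of b' "take j w" "drop j w"] show ?thesis by auto
      qed
      then show ?thesis by (simp add: split)
    qed
    ultimately show ?thesis using "1.IH" by blast
  qed
qed


section \<open>Automata observed through a finite-memory transducer\<close>

lemma trans_ext_append: "trans_ext G x (s @ t) = (\<Union>y\<in>trans_ext G x s. trans_ext G y t)"
  by (induction s arbitrary: x) auto

lemma trans_ext_states:
  assumes "nfa G" "x \<in> states G" "s \<in> lists (events G)"
  shows "trans_ext G x s \<subseteq> states G"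
  using assms(2,3)
proof (induction s arbitrary: x)
  case (Cons a s)
  then have "trans G x a \<subseteq> states G" using assms(1) unfolding nfa_def by auto
  with Cons show ?case by auto
qed simp

fun transduce :: "('m \<Rightarrow> 'e \<Rightarrow> 'm) \<Rightarrow> ('m \<Rightarrow> 'e \<Rightarrow> 'o list) \<Rightarrow> 'm \<Rightarrow> 'e list \<Rightarrow> 'o list" where
  "transduce upd out m [] = []"
| "transduce upd out m (\<sigma> # s) = out m \<sigma> @ transduce upd out (upd m \<sigma>) s"

lemma transduce_append:
  "transduce upd out m (s @ t) = transduce upd out m s @ transduce upd out (foldl upd m s) t"
  by (induction s arbitrary: m) auto

text \<open>With at most one symbol per event, no cut of the output falls inside the output of a
  single event, so every cut lifts to the input.\<close>

lemma transduce_split: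
  assumes "\<And>m \<sigma>. length (out m \<sigma>) \<le> 1" and "transduce upd out m t = u @ v"
  shows "\<exists>t1 t2. t = t1 @ t2 \<and> transduce upd out m t1 = u \<and>
           transduce upd out (foldl upd m t1) t2 = v"
  using assms(2)
proof (induction t arbitrary: m u)
  case (Cons a t)
  show ?case
  proof (cases u)
    case Nil
    with Cons.prems show ?thesis by (intro exI[of _ "[]"] exI[of _ "a # t"]) simp
  next
    case (Cons b u')
    \<comment> \<open>An empty output is a prefix of anything; a single symbol must be the head of
      the nonempty \<open>u\<close>.\<close>
    have "\<exists>u''. u = out m a @ u''"
      using assms(1)[of m a] Cons.prems Cons by (cases "out m a") auto
    then obtain u'' where u: "u = out m a @ u''" ..
    with Cons.prems have "transduce upd out (upd m a) t = u'' @ v" by simp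
    from Cons.IH[OF this] obtain t1 t2 where "t = t1 @ t2"
      "transduce upd out (upd m a) t1 = u''"
      "transduce upd out (foldl upd (upd m a) t1) t2 = v" by blast
    with u show ?thesis by (intro exI[of _ "a # t1"] exI[of _ t2]) simp
  qed
qed simp

text \<open>Treats both projections at once, as outputs of a deterministic transducer whose memories
  stay in the finite set \<open>M\<close>.\<close>

locale observed_automaton =
  fixes G :: "('x, 'e) automaton" and \<Pi> :: "'e list \<Rightarrow> 'o list"
    and upd :: "'m \<Rightarrow> 'e \<Rightarrow> 'm" and out :: "'m \<Rightarrow> 'e \<Rightarrow> 'o list" and m0 :: 'm and M :: "'m set"
  assumes nfa: "nfa G"
    and \<Pi>_eq: "\<And>s. \<Pi> s = transduce upd out m0 s"
    and out_le: "\<And>m \<sigma>. length (out m \<sigma>) \<le> 1"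
    and fin_M: "finite M" and m0: "m0 \<in> M"
    and upd_M: "\<And>m \<sigma>. m \<in> M \<Longrightarrow> upd m \<sigma> \<in> M"
begin

lemma foldl_upd_M: "m \<in> M \<Longrightarrow> foldl upd m s \<in> M"
  by (induction s arbitrary: m) (auto simp: upd_M)

definition Q :: "('x \<times> 'm) set" where
  "Q = states G \<times> M"

text \<open>Silent events may occur anywhere in \<open>t\<close>, also at its ends, so
  \<open>succs q []\<close> is the unobservable reach of \<open>q\<close>.\<close>

definition succs :: "'x \<times> 'm \<Rightarrow> 'o list \<Rightarrow> ('x \<times> 'm) set" where
  "succs q \<beta> = {(y, foldl upd (snd q) t) | y t.
     t \<in> lists (events G) \<and> y \<in> trans_ext G (fst q) t \<and> transduce upd out (snd q) t = \<beta>}"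

definition reached :: "'o list \<Rightarrow> ('x \<times> 'm) set" where
  "reached \<alpha> = (\<Union>x0\<in>initials G. succs (x0, m0) \<alpha>)"

lemma finite_Q: "finite Q"
  using nfa fin_M unfolding Q_def nfa_def by simp

lemma succs_Q: "q \<in> Q \<Longrightarrow> succs q \<beta> \<subseteq> Q"
  using trans_ext_states[OF nfa] foldl_upd_M unfolding Q_def succs_def by fastforce

lemma reached_Q: "reached \<alpha> \<subseteq> Q"
proof -
  have "(x0, m0) \<in> Q" if "x0 \<in> initials G" for x0
    using that nfa m0 unfolding Q_def nfa_def by auto
  then show ?thesis using succs_Q unfolding reached_def by blast
qed

text \<open>This is the splitting law required for pumping; the forward inclusion rests on
  \<open>transduce_split\<close>.\<close>

lemma succs_append: "succs q (u @ v) = (\<Union>p\<in>succs q u. succs p v)"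
proof (intro equalityI subsetI)
  fix z assume "z \<in> succs q (u @ v)"
  then obtain y t where t: "z = (y, foldl upd (snd q) t)" "t \<in> lists (events G)"
    "y \<in> trans_ext G (fst q) t" "transduce upd out (snd q) t = u @ v"
    unfolding succs_def by blast
  obtain t1 t2 where s: "t = t1 @ t2" "transduce upd out (snd q) t1 = u"
    "transduce upd out (foldl upd (snd q) t1) t2 = v"
    using transduce_split[OF out_le t(4)] by blast
  obtain x where x: "x \<in> trans_ext G (fst q) t1" "y \<in> trans_ext G x t2"
    using t(3) s(1) by (auto simp: trans_ext_append)
  have "(x, foldl upd (snd q) t1) \<in> succs q u"
    using x(1) s t(2) unfolding succs_def by auto
  moreover have "z \<in> succs (x, foldl upd (snd q) t1) v"
    using x(2) s t(1,2) unfolding succs_def by auto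
  ultimately show "z \<in> (\<Union>p\<in>succs q u. succs p v)" by blast
next
  fix z assume "z \<in> (\<Union>p\<in>succs q u. succs p v)"
  then obtain x t1 y t2 where t1: "t1 \<in> lists (events G)" "x \<in> trans_ext G (fst q) t1"
      "transduce upd out (snd q) t1 = u"
    and t2: "t2 \<in> lists (events G)" "y \<in> trans_ext G x t2"
      "transduce upd out (foldl upd (snd q) t1) t2 = v"
    and z: "z = (y, foldl upd (foldl upd (snd q) t1) t2)"
    unfolding succs_def by auto
  then show "z \<in> succs q (u @ v)"
    unfolding succs_def
    by (auto simp: transduce_append trans_ext_append intro!: exI[of _ "t1 @ t2"])
qed

text \<open>What \<open>t\<close> adds to the observation depends on the past \<open>s\<close> only
  through the memory after \<open>s\<close>. The memory is quantified because different pasts with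
  observation \<alpha> may reach \<open>x\<close> with different memories.\<close>

lemma delayed_estimate_iff:
  "x \<in> delayed_estimate G \<Pi> \<alpha> (\<alpha> @ \<beta>) \<longleftrightarrow>
     (\<exists>m. (x, m) \<in> reached \<alpha> \<and> succs (x, m) \<beta> \<noteq> {})"
proof
  assume "x \<in> delayed_estimate G \<Pi> \<alpha> (\<alpha> @ \<beta>)"
  then obtain x0 s t where *: "x0 \<in> initials G" "s \<in> lang_from G x0" "t \<in> lang_from G x"
    "\<Pi> s = \<alpha>" "x \<in> trans_ext G x0 s" "\<Pi> (s @ t) = \<alpha> @ \<beta>"
    unfolding delayed_estimate_def by blast
  have "(x, foldl upd m0 s) \<in> reached \<alpha>"
    using * unfolding reached_def succs_def lang_from_def \<Pi>_eq by auto
  moreover have "succs (x, foldl upd m0 s) \<beta> \<noteq> {}"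
    using * unfolding succs_def lang_from_def \<Pi>_eq by (auto simp: transduce_append)
  ultimately show "\<exists>m. (x, m) \<in> reached \<alpha> \<and> succs (x, m) \<beta> \<noteq> {}" by blast
next
  assume "\<exists>m. (x, m) \<in> reached \<alpha> \<and> succs (x, m) \<beta> \<noteq> {}"
  then obtain m where m: "(x, m) \<in> reached \<alpha>" "succs (x, m) \<beta> \<noteq> {}" by blast
  from m(1) obtain x0 s where s: "x0 \<in> initials G" "s \<in> lists (events G)"
    "x \<in> trans_ext G x0 s" "m = foldl upd m0 s" "transduce upd out m0 s = \<alpha>"
    unfolding reached_def succs_def by auto
  from m(2) obtain t where t: "t \<in> lists (events G)" "trans_ext G x t \<noteq> {}"
    "transduce upd out m t = \<beta>"
    unfolding succs_def by auto
  have "x \<in> states G" using m(1) reached_Q unfolding Q_def by blast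
  moreover have "s \<in> lang_from G x0" "t \<in> lang_from G x"
    using s t unfolding lang_from_def by auto
  moreover have "\<Pi> s = \<alpha>" "\<Pi> (s @ t) = \<alpha> @ \<beta>"
    using s t unfolding \<Pi>_eq by (auto simp: transduce_append)
  ultimately show "x \<in> delayed_estimate G \<Pi> \<alpha> (\<alpha> @ \<beta>)"
    using s(1,3) unfolding delayed_estimate_def by blast
qed

text \<open>A run of \<open>s @ t\<close> passes through some state after \<open>s\<close>, which
  then belongs to the estimate. This lets anonymity be stated over observations alone.\<close>

lemma observable_iff:
  "(\<exists>s t. s @ t \<in> lang G \<and> \<Pi> s = \<alpha> \<and> \<Pi> (s @ t) = \<alpha> @ \<beta>) \<longleftrightarrow>
     delayed_estimate G \<Pi> \<alpha> (\<alpha> @ \<beta>) \<noteq> {}"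
proof
  assume "\<exists>s t. s @ t \<in> lang G \<and> \<Pi> s = \<alpha> \<and> \<Pi> (s @ t) = \<alpha> @ \<beta>"
  then obtain s t x0 where st: "x0 \<in> initials G" "s @ t \<in> lang_from G x0"
    "\<Pi> s = \<alpha>" "\<Pi> (s @ t) = \<alpha> @ \<beta>"
    unfolding lang_def by blast
  then obtain x where *: "x0 \<in> initials G" "s \<in> lists (events G)" "t \<in> lists (events G)"
    "x \<in> trans_ext G x0 s" "trans_ext G x t \<noteq> {}" "\<Pi> s = \<alpha>" "\<Pi> (s @ t) = \<alpha> @ \<beta>"
    unfolding lang_from_def by (auto simp: trans_ext_append)
  have "x \<in> states G"
    using trans_ext_states[OF nfa _ *(2)] * nfa unfolding nfa_def by blast
  moreover have "s \<in> lang_from G x0" "t \<in> lang_from G x"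
    using * unfolding lang_from_def by auto
  ultimately have "x \<in> delayed_estimate G \<Pi> \<alpha> (\<alpha> @ \<beta>)"
    using *(1,4,6,7) unfolding delayed_estimate_def by blast
  then show "delayed_estimate G \<Pi> \<alpha> (\<alpha> @ \<beta>) \<noteq> {}" by blast
next
  assume "delayed_estimate G \<Pi> \<alpha> (\<alpha> @ \<beta>) \<noteq> {}"
  then obtain x x0 s t where *: "x0 \<in> initials G" "s \<in> lang_from G x0" "t \<in> lang_from G x"
    "\<Pi> s = \<alpha>" "x \<in> trans_ext G x0 s" "\<Pi> (s @ t) = \<alpha> @ \<beta>"
    unfolding delayed_estimate_def by blast
  then have "s @ t \<in> lang G"
    unfolding lang_def lang_from_def by (auto simp: trans_ext_append)
  with * show "\<exists>s t. s @ t \<in> lang G \<and> \<Pi> s = \<alpha> \<and> \<Pi> (s @ t) = \<alpha> @ \<beta>" by blast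
qed

lemma step_anonymous_iff:
  "step_anonymous K G \<Pi> \<longleftrightarrow>
     (\<forall>\<alpha> \<beta>. length \<beta> \<le> K \<and> delayed_estimate G \<Pi> \<alpha> (\<alpha> @ \<beta>) \<noteq> {} \<longrightarrow>
        card (delayed_estimate G \<Pi> \<alpha> (\<alpha> @ \<beta>)) > 1)"
  unfolding step_anonymous_def observable_iff[symmetric] by blast

text \<open>\<open>K'\<close> is arbitrary: any violation shrinks to one with a continuation shorter
  than the bound, hence within \<open>K\<close>.\<close>

lemma step_anonymous_saturates:
  assumes anon: "step_anonymous K G \<Pi>" and K: "K \<ge> card Q * 2 ^ card Q"
  shows "step_anonymous K' G \<Pi>"
  unfolding step_anonymous_iff
proof (intro allI impI, rule ccontr)
  fix \<alpha> \<beta>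
  let ?E = "\<lambda>\<beta>. delayed_estimate G \<Pi> \<alpha> (\<alpha> @ \<beta>)"
  assume E: "length \<beta> \<le> K' \<and> ?E \<beta> \<noteq> {}" and "\<not> card (?E \<beta>) > 1"
  moreover have "finite (?E \<beta>)"
    using nfa unfolding delayed_estimate_def nfa_def by simp
  \<comment> \<open>Finiteness and nonemptiness exclude cardinality 0.\<close>
  ultimately have "card (?E \<beta>) = 1"
    by (metis card_0_eq less_one linorder_neqE_nat)
  then obtain x where x: "?E \<beta> = {x}" by (meson card_1_singletonE)
  then obtain m where m: "(x, m) \<in> reached \<alpha>" "succs (x, m) \<beta> \<noteq> {}"
    using delayed_estimate_iff[of x \<alpha> \<beta>] by blast
  \<comment> \<open>Only these pairs could add a second state to the estimate; a pair
    \<open>(x, m')\<close> with another memory would contribute \<open>x\<close> again.\<close>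
  define B where "B = {b \<in> reached \<alpha>. fst b \<noteq> x}"
  have "\<forall>b\<in>B. succs b \<beta> = {}"
    using x delayed_estimate_iff[of _ \<alpha> \<beta>] unfolding B_def by force
  moreover have "B \<subseteq> Q" "(x, m) \<in> Q"
    using m(1) reached_Q unfolding B_def by auto
  ultimately obtain \<beta>' where \<beta>': "length \<beta>' < card Q * 2 ^ card Q"
    "succs (x, m) \<beta>' \<noteq> {}" "\<forall>b\<in>B. succs b \<beta>' = {}"
    using shorten_separating_word[of succs Q "(x, m)" B \<beta>, OF succs_append succs_Q finite_Q] m(2)
    by auto
  have "?E \<beta>' = {x}"
  proof (intro equalityI subsetI)
    fix y assume "y \<in> ?E \<beta>'"
    then obtain m' where "(y, m') \<in> reached \<alpha>" "succs (y, m') \<beta>' \<noteq> {}"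
      unfolding delayed_estimate_iff by blast
    with \<beta>'(3) show "y \<in> {x}" unfolding B_def by force
  next
    fix y assume "y \<in> {x}"
    with m(1) \<beta>'(2) show "y \<in> ?E \<beta>'" unfolding delayed_estimate_iff by blast
  qed
  with anon \<beta>'(1) K show False unfolding step_anonymous_iff
    by (metis card_1_singleton_iff One_nat_def empty_not_insert less_imp_le less_irrefl
        less_le_trans)
qed

lemma step_anonymous_eq:
  assumes "K' > K" and "K \<ge> card Q * 2 ^ card Q"
  shows "step_anonymous K G \<Pi> \<longleftrightarrow> step_anonymous K' G \<Pi>"
  using assms step_anonymous_saturates by (meson le_trans less_imp_le)

end


section \<open>The two projections as transducers\<close>

lemma P_str_eq_transduce:
  "P_str \<Sigma>\<^sub>o \<Gamma> s = transduce (\<lambda>_ _. ())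
     (\<lambda>_ \<sigma>. if \<sigma> \<in> \<Gamma> then [Inr ()] else if \<sigma> \<in> \<Sigma>\<^sub>o then [Inl \<sigma>] else []) () s"
  by (induction s rule: rev_induct) (auto simp: transduce_append)

text \<open>Folding this over a string lists its anonymous events in order of first occurrence, the
  memory that the weak projection needs.\<close>

definition record_event :: "'e set \<Rightarrow> 'e list \<Rightarrow> 'e \<Rightarrow> 'e list" where
  "record_event \<Gamma> ws \<sigma> = (if \<sigma> \<in> \<Gamma> \<and> \<sigma> \<notin> set ws then ws @ [\<sigma>] else ws)"

lemma set_record: "set (foldl (record_event \<Gamma>) [] s) = \<Gamma> \<inter> set s"
  by (induction s rule: rev_induct) (auto simp: record_event_def)

text \<open>New events are recorded at the end, so once \<sigma> has occurred the part of the record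
  before it is frozen.\<close>

lemma takeWhile_record:
  assumes "\<sigma> \<in> \<Gamma>"
  shows "takeWhile (\<lambda>\<tau>. \<tau> \<noteq> \<sigma>) (foldl (record_event \<Gamma>) [] s) =
           foldl (record_event \<Gamma>) [] (takeWhile (\<lambda>\<tau>. \<tau> \<noteq> \<sigma>) s)"
proof (induction s rule: rev_induct)
  case (snoc \<tau> s)
  define w where "w = foldl (record_event \<Gamma>) [] s"
  have mem: "\<sigma> \<in> set w \<longleftrightarrow> \<sigma> \<in> set s"
    using assms by (simp add: w_def set_record)
  have "takeWhile (\<lambda>\<tau>. \<tau> \<noteq> \<sigma>) (record_event \<Gamma> w \<tau>) =
      foldl (record_event \<Gamma>) [] (takeWhile (\<lambda>\<tau>. \<tau> \<noteq> \<sigma>) (s @ [\<tau>]))"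
  proof (cases "\<sigma> \<in> set s")
    case True
    then have "takeWhile (\<lambda>\<tau>. \<tau> \<noteq> \<sigma>) (record_event \<Gamma> w \<tau>) = takeWhile (\<lambda>\<tau>. \<tau> \<noteq> \<sigma>) w"
      using mem by (auto simp: record_event_def takeWhile_append)
    moreover have "takeWhile (\<lambda>\<tau>. \<tau> \<noteq> \<sigma>) (s @ [\<tau>]) = takeWhile (\<lambda>\<tau>. \<tau> \<noteq> \<sigma>) s"
      using True by (auto simp: takeWhile_append)
    ultimately show ?thesis using snoc by (simp add: w_def)
  next
    \<comment> \<open>Before \<sigma> occurs nothing is cut off on either side, so only the arrival
      of \<sigma> itself needs separate treatment.\<close>
    case False
    then have "takeWhile (\<lambda>\<tau>. \<tau> \<noteq> \<sigma>) w = w"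
      using mem by (auto simp: takeWhile_eq_all_conv)
    then have "takeWhile (\<lambda>\<tau>. \<tau> \<noteq> \<sigma>) (record_event \<Gamma> w \<tau>) =
        (if \<tau> = \<sigma> then w else record_event \<Gamma> w \<tau>)"
      using False mem assms by (auto simp: takeWhile_append record_event_def)
    moreover have "takeWhile (\<lambda>\<tau>. \<tau> \<noteq> \<sigma>) (s @ [\<tau>]) = (if \<tau> = \<sigma> then s else s @ [\<tau>])"
      using False by (auto simp: takeWhile_append)
    ultimately show ?thesis by (simp add: w_def)
  qed
  then show ?case by (simp add: w_def)
qed simp

text \<open>The rank depends only on the set of anonymous events before the first \<sigma>, and the
  string and its record agree on that set.\<close>

lemma rank_record:
  assumes "\<sigma> \<in> \<Gamma>"
  shows "rank \<Gamma> (s @ [\<sigma>]) \<sigma> = rank \<Gamma> (foldl (record_event \<Gamma>) [] s @ [\<sigma>]) \<sigma>"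
proof -
  have *: "takeWhile (\<lambda>\<tau>. \<tau> \<noteq> \<sigma>) (v @ [\<sigma>]) = takeWhile (\<lambda>\<tau>. \<tau> \<noteq> \<sigma>) v" for v
    by (induction v) auto
  show ?thesis
    unfolding rank_def anon_events_def * takeWhile_record[OF assms] set_record by auto
qed

lemma P_w_eq_transduce:
  "P_w \<Sigma>\<^sub>o \<Gamma> s = transduce (record_event \<Gamma>)
     (\<lambda>ws \<sigma>. if \<sigma> \<in> \<Gamma> then [Inr (rank \<Gamma> (ws @ [\<sigma>]) \<sigma>)] else if \<sigma> \<in> \<Sigma>\<^sub>o then [Inl \<sigma>] else []) [] s"
  by (induction s rule: rev_induct) (auto simp: transduce_append rank_record[symmetric])

section \<open>Counting the augmented states\<close>

lemma inj_indexed_events: "inj indexed_events"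
proof (rule injI)
  fix ws vs :: "'e list"
  assume eq: "indexed_events ws = indexed_events vs"
  \<comment> \<open>Indices start at 1, so position \<open>k\<close> carries the index
    \<open>Suc k\<close>; each entry can be read back from the set.\<close>
  have mem: "(a, Suc k) \<in> indexed_events us \<longleftrightarrow> k < length us \<and> a = us ! k" for a k and us :: "'e list"
    unfolding indexed_events_def by auto
  have "k < length ws \<longleftrightarrow> k < length vs" for k
    using eq mem by metis
  then have "length ws = length vs" by (metis linorder_neqE_nat less_irrefl)
  moreover have "ws ! k = vs ! k" if "k < length ws" for k
    using eq mem that by metis
  ultimately show "ws = vs" by (simp add: nth_equalityI)
qed

lemma card_augmented_states:
  "card (augmented_states G \<Gamma>) = card (states G \<times> {ws. distinct ws \<and> set ws \<subseteq> \<Gamma>})"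
proof -
  have "{indexed_events ws | ws. distinct ws \<and> set ws \<subseteq> \<Gamma>} =
      indexed_events ` {ws. distinct ws \<and> set ws \<subseteq> \<Gamma>}" by auto
  then show ?thesis
    unfolding augmented_states_def
    by (simp add: card_cartesian_product card_image inj_on_subset[OF inj_indexed_events])
qed

theorem proposition2:
  fixes G :: "('x, 'e) automaton" and \<Sigma>\<^sub>o \<Sigma>\<^sub>u\<^sub>o \<Gamma> :: "'e set"
  assumes "nfa G"
    and "events G = \<Sigma>\<^sub>o \<union> \<Sigma>\<^sub>u\<^sub>o" and "\<Sigma>\<^sub>o \<inter> \<Sigma>\<^sub>u\<^sub>o = {}"
    and "\<Gamma> \<subseteq> \<Sigma>\<^sub>o" and "card \<Gamma> \<ge> 2"
  shows "(\<forall>(K::nat) (K'::nat). K' > K \<and> K \<ge> card (states G) * 2 ^ card (states G) \<longrightarrow>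
            (strongly_anonymous K G \<Sigma>\<^sub>o \<Gamma> \<longleftrightarrow> strongly_anonymous K' G \<Sigma>\<^sub>o \<Gamma>)) \<and>
         (\<forall>(K::nat) (K'::nat). K' > K \<and> K \<ge> card (augmented_states G \<Gamma>) * 2 ^ card (augmented_states G \<Gamma>) \<longrightarrow>
            (weakly_anonymous K G \<Sigma>\<^sub>o \<Gamma> \<longleftrightarrow> weakly_anonymous K' G \<Sigma>\<^sub>o \<Gamma>))"
proof -
  \<comment> \<open>A one-element memory suffices, so \<open>str.Q\<close> is as large as the state
    set.\<close>
  interpret str: observed_automaton G "P_str \<Sigma>\<^sub>o \<Gamma>" "\<lambda>_ _. ()"
    "\<lambda>_ \<sigma>. if \<sigma> \<in> \<Gamma> then [Inr ()] else if \<sigma> \<in> \<Sigma>\<^sub>o then [Inl \<sigma>] else []" "()" UNIV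
    by unfold_locales (auto simp: assms(1) P_str_eq_transduce)
  \<comment> \<open>An infinite set has cardinality 0 by convention, below 2.\<close>
  have "finite \<Gamma>" using assms(5) by (metis card.infinite not_numeral_le_zero)
  then have fin: "finite {ws. distinct ws \<and> set ws \<subseteq> \<Gamma>}"
    using finite_subset_distinct[of \<Gamma>] by (simp add: conj_commute)
  \<comment> \<open>The memories are the duplicate-free lists over \<Gamma>, which correspond to the
    second components of the augmented states.\<close>
  interpret w: observed_automaton G "P_w \<Sigma>\<^sub>o \<Gamma>" "record_event \<Gamma>"
    "\<lambda>ws \<sigma>. if \<sigma> \<in> \<Gamma> then [Inr (rank \<Gamma> (ws @ [\<sigma>]) \<sigma>)] else if \<sigma> \<in> \<Sigma>\<^sub>o then [Inl \<sigma>] else []"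
    "[]" "{ws. distinct ws \<and> set ws \<subseteq> \<Gamma>}"
    by unfold_locales (use fin in \<open>auto simp: assms(1) P_w_eq_transduce record_event_def\<close>)
  have "card str.Q = card (states G)"
    by (simp add: str.Q_def card_cartesian_product)
  moreover have "card w.Q = card (augmented_states G \<Gamma>)"
    by (simp add: w.Q_def card_augmented_states)
  ultimately show ?thesis
    unfolding strongly_anonymous_def weakly_anonymous_def
    by (auto simp: str.step_anonymous_eq w.step_anonymous_eq)
qed

end
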